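(* The space $\mathfrak{T}_1$, equipped with the metric $\eta$, has the convergence-symmetry property.
   Context: $\mathbb{R}_+^*$ denotes the set of positive reals. $\mathfrak{T}_1=\{(A_1,A_2,A_3)\in(\mathbb{R}_+^* )^3:(A_1+A_2+A_3)A_1A_2A_3=1\}$ (the space of marked unit area Euclidean triangles). The metric $\eta$ on $\mathfrak{T}_1$ (not symmetric) is $\eta((A_1,A_2,A_3),(A_1',A_2',A_3'))=\log\max\{A_1'/A_1,A_2'/A_2,A_3'/A_3\}$. A (not necessarily symmetric) metric space $(X,d)$ has the convergence-symmetry property if for any two sequences $(p_n)$, $(q_n)$ in $X$ with $d(p_n,q_n)\to0$ one also has $d(q_n,p_n)\to0$ as $n\to\infty$. *)

theory Defs
  imports Complex_Main
begin

definition marked_unit_triangles :: "(real \<times> real \<times> real) set" where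
  "marked_unit_triangles =
     {(A1, A2, A3). A1 > 0 \<and> A2 > 0 \<and> A3 > 0 \<and> (A1 + A2 + A3) * A1 * A2 * A3 = 1}"

fun eta :: "real \<times> real \<times> real \<Rightarrow> real \<times> real \<times> real \<Rightarrow> real" where
  "eta (A1, A2, A3) (B1, B2, B3) = ln (Max {B1 / A1, B2 / A2, B3 / A3})"

text \<open>The distance \<open>d\<close> on the carrier \<open>X\<close> is not assumed to be symmetric, so the order of its
  arguments matters.\<close>

definition convergence_symmetry :: "'a set \<Rightarrow> ('a \<Rightarrow> 'a \<Rightarrow> real) \<Rightarrow> bool" where
  "convergence_symmetry X d \<longleftrightarrow>
     (\<forall>p q :: nat \<Rightarrow> 'a. (\<forall>n. p n \<in> X) \<longrightarrow> (\<forall>n. q n \<in> X) \<longrightarrow>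
        (\<lambda>n. d (p n) (q n)) \<longlonglongrightarrow> 0 \<longrightarrow> (\<lambda>n. d (q n) (p n)) \<longlonglongrightarrow> 0)"

end

theory Submission
  imports Defs
begin

text \<open>Put $M = \max_i A'_i / A_i$. The product $(A_1+A_2+A_3) A_1 A_2 A_3$ equals 1 at both triangles,
  and its four linear factors grow by at most $M$ each. So no factor can shrink by more than
  $M^{-3}$, which gives $\eta(q,p) \le 3\,\eta(p,q)$. Using this inequality in both directions
  also yields $\eta \ge 0$, and the claim follows by squeezing.\<close>

text \<open>Of the four factors of the product at \<open>(x, y, z)\<close>, the sum,
  \<open>y\<close> and \<open>z\<close> are at most \<open>M\<close> times their counterparts. Both
  products are 1, so the remaining factor \<open>x\<close> cannot fall below
  \<open>a / M ^ 3\<close>.\<close>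

lemma ratio_le_cube_of_bound:
  fixes a b c x y z M :: real
  assumes "a > 0" "b > 0" "c > 0" "x > 0" "y > 0" "z > 0"
    and abc: "(a + b + c) * a * b * c = 1" and xyz: "(x + y + z) * x * y * z = 1"
    and le: "x \<le> M * a" "y \<le> M * b" "z \<le> M * c"
  shows "a / x \<le> M ^ 3"
proof -
  have "x + y + z \<le> M * (a + b + c)"
    using le by (simp add: algebra_simps)
  then have "(x + y + z) * y * z \<le> (M * (a + b + c)) * (M * b) * (M * c)"
    using assms by (intro mult_mono) auto
  \<comment> \<open>The factor \<open>a * x\<close> completes both sides to full products, each
    equal to 1; what remains is \<open>a\<close> on the left and \<open>M ^ 3 * x\<close> on the
    right.\<close>
  then have "((x + y + z) * y * z) * (a * x) \<le> ((M * (a + b + c)) * (M * b) * (M * c)) * (a * x)"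
    using assms by (intro mult_right_mono) auto
  also have "\<dots> = M ^ 3 * x * ((a + b + c) * a * b * c)"
    by (simp add: power3_eq_cube algebra_simps)
  also have "((x + y + z) * y * z) * (a * x) = a * ((x + y + z) * x * y * z)"
    by (simp add: algebra_simps)
  finally have "a \<le> M ^ 3 * x"
    using abc xyz by simp
  then show ?thesis
    using \<open>x > 0\<close> by (simp add: divide_le_eq)
qed

lemma eta_reverse_le:
  assumes "p \<in> marked_unit_triangles" "q \<in> marked_unit_triangles"
  shows "eta q p \<le> 3 * eta p q"
proof -
  obtain a b c x y z where p: "p = (a, b, c)" and q: "q = (x, y, z)"
    by (metis prod_cases3)
  have pos: "a > 0" "b > 0" "c > 0" "x > 0" "y > 0" "z > 0"
    and abc: "(a + b + c) * a * b * c = 1" and xyz: "(x + y + z) * x * y * z = 1"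
    using assms by (auto simp: p q marked_unit_triangles_def)
  \<comment> \<open>Here \<open>ln M\<close> is \<open>eta p q\<close>, so a bound
    \<open>M ^ 3\<close> on the reversed ratios becomes the factor 3 under the logarithm.\<close>
  define M where "M = Max {x / a, y / b, z / c}"
  have "x / a \<le> M" "y / b \<le> M" "z / c \<le> M"
    unfolding M_def by (simp_all add: le_max_iff_disj)
  then have le: "x \<le> M * a" "y \<le> M * b" "z \<le> M * c"
    using pos by (simp_all add: divide_le_eq)
  have "M > 0"
    using pos \<open>x / a \<le> M\<close> by (meson divide_pos_pos less_le_trans)
  have "a / x \<le> M ^ 3"
    using pos abc xyz le by (rule ratio_le_cube_of_bound)
  moreover have "b / y \<le> M ^ 3"
    \<comment> \<open>The normalisation is symmetric in the coordinates, so the same permutation of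
      both triples brings the wanted ratio to the front.\<close>
    by (rule ratio_le_cube_of_bound[of b a c y x z]) (use pos abc xyz le in \<open>simp_all add: ac_simps\<close>)
  moreover have "c / z \<le> M ^ 3"
    by (rule ratio_le_cube_of_bound[of c a b z x y]) (use pos abc xyz le in \<open>simp_all add: ac_simps\<close>)
  ultimately have "Max {a / x, b / y, c / z} \<le> M ^ 3"
    by simp
  moreover have "Max {a / x, b / y, c / z} > 0"
    using pos by (simp add: less_max_iff_disj)
  ultimately have "ln (Max {a / x, b / y, c / z}) \<le> ln (M ^ 3)"
    using \<open>M > 0\<close> by (subst ln_le_cancel_iff) auto
  also have "\<dots> = 3 * ln M"
    using \<open>M > 0\<close> by (simp add: ln_realpow)
  finally show ?thesis
    unfolding p q eta.simps M_def .
qed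

text \<open>Chaining the two directions gives \<open>eta p q\<close> \<le>
  \<open>3 * eta q p\<close> \<le> \<open>9 * eta p q\<close>, which a negative value would
  violate.\<close>

lemma eta_nonneg:
  assumes "p \<in> marked_unit_triangles" "q \<in> marked_unit_triangles"
  shows "eta p q \<ge> 0"
  using eta_reverse_le[OF assms] eta_reverse_le[OF assms(2,1)] by linarith

theorem corollary8p3:
  shows "convergence_symmetry marked_unit_triangles eta"
  unfolding convergence_symmetry_def
proof (intro allI impI)
  fix p q :: "nat \<Rightarrow> real \<times> real \<times> real"
  assume mem: "\<forall>n. p n \<in> marked_unit_triangles" "\<forall>n. q n \<in> marked_unit_triangles"
    and lim: "(\<lambda>n. eta (p n) (q n)) \<longlonglongrightarrow> 0"
  show "(\<lambda>n. eta (q n) (p n)) \<longlonglongrightarrow> 0"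
  \<comment> \<open>The lower bound is the constant 0, by \<open>eta_nonneg\<close> for the reversed
    pair; both bounds hold for every \<open>n\<close>.\<close>
  proof (rule tendsto_sandwich[OF _ _ tendsto_const])
    show "(\<lambda>n. 3 * eta (p n) (q n)) \<longlonglongrightarrow> 0"
      using tendsto_mult_left[OF lim, of 3] by simp
  qed (use mem in \<open>auto intro!: always_eventually eta_nonneg eta_reverse_le\<close>)
qed

end
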